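(* For every integer $n>1$, the space $LO(\mathbb{Z}^n)$ of left orders on the group $\mathbb{Z}^n$ is homeomorphic to the Cantor set.
   Context: A left order on a group $G$ is a (strict) linear order $<$ on $G$ such that $a<b$ implies $ca<cb$ for all $a,b,c\in G$ (for $\mathbb{Z}^n$, written additively: $a<b$ implies $c+a<c+b$). $LO(G)$ denotes the set of all left orders on $G$, endowed with the smallest topology for which all the sets $U_{a,b}=\{<\,\in LO(G): a<b\}$, $a,b\in G$, are open. *)

theory Defs
  imports "HOL-Analysis.Analysis"
begin

(* Groups are written additively; the class group_add does not assume commutativity.
   A strict order < is represented by the set of pairs (a, b) with a < b. *)

definition left_order :: "('a::group_add) rel \<Rightarrow> bool" where
  "left_order r \<longleftrightarrow> strict_linear_order r \<and> (\<forall>a b c. (a, b) \<in> r \<longrightarrow> (c + a, c + b) \<in> r)"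

definition left_orders :: "('a::group_add) rel set" where
  "left_orders = {r. left_order r}"

definition left_orders_less :: "'a::group_add \<Rightarrow> 'a \<Rightarrow> 'a rel set" where
  "left_orders_less a b = {r \<in> left_orders. (a, b) \<in> r}"

(* topology_generated_by takes the union of the generators as the underlying space.
   Listing left_orders among them makes it the underlying space for every group, the
   trivial one included (whose only left order is empty and lies in no left_orders_less a b). *)

definition left_order_topology :: "('a::group_add) rel topology" where
  "left_order_topology =
     topology_generated_by (insert left_orders {left_orders_less a b |a b. True})"

lemma topspace_left_order_topology: "topspace left_order_topology = left_orders"
  by (auto simp: left_order_topology_def left_orders_less_def)

lemma openin_left_orders_less: "openin left_order_topology (left_orders_less a b)"
  unfolding left_order_topology_def by (rule topology_generated_by_Basis) blast

lemma left_order_topology_coarsest: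
  assumes "topspace T = left_orders" and "\<And>a b. openin T (left_orders_less a b)"
    and "openin left_order_topology U"
  shows "openin T U"
proof (rule generate_topology_on_coarsest)
  show "istopology (openin T)"
    by simp
  show "openin T S" if "S \<in> insert left_orders {left_orders_less a b |a b. True}" for S
    using that assms(1,2) openin_topspace[of T] by auto
  show "generate_topology_on (insert left_orders {left_orders_less a b |a b. True}) U"
    using assms(3) unfolding left_order_topology_def by (simp add: openin_topology_generated_by)
qed

(* The middle-thirds Cantor set: both thirds kept at each step are scaled copies
   of the whole previous stage. *)

primrec cantor_stage :: "nat \<Rightarrow> real set" where
  "cantor_stage 0 = {0..1}"
| "cantor_stage (Suc k) =
     (\<lambda>x. x / 3) ` cantor_stage k \<union> (\<lambda>x. (x + 2) / 3) ` cantor_stage k"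

definition cantor_set :: "real set" where
  "cantor_set = (\<Inter>k. cantor_stage k)"

end

theory Submission
  imports Defs
begin

text \<open>
A left order on an abelian group is the same thing as its cone of positive elements: a subset
\<open>P\<close> closed under addition, with \<open>0 \<notin> P\<close>, that contains \<open>x\<close> or \<open>- x\<close> for every \<open>x \<noteq> 0\<close>.
The theorem holds for every countable torsion-free abelian group in which two elements are
linearly independent, for the following reasons.

The space of left orders is compact, because the axioms of a left order are closed conditions on
the membership function of the relation, a point of a product of two-point spaces. The sets of
orders in which a given element is positive are clopen, there are countably many of them, and
together they separate the orders. So by the classical characterization of the Cantor set it
remains to see that there are orders and that none of them is isolated.

Both facts rest on the extension theorem \<open>positive_cone_extension\<close>: in a torsion-free
abelian group every subsemigroup avoiding \<open>0\<close> lies in a positive cone. If \<open>P\<close> were isolated,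
then \<open>P\<close> would be the only positive cone containing some finite set \<open>F \<subseteq> P\<close>. When
\<open>F\<close> has two distinct elements, one of them is larger than the other, and the larger one turns out
to be redundant (\<open>isolates_remove_larger\<close>): \<open>P\<close> is already the only positive cone containing the
remaining ones. Discarding such elements repeatedly leaves a single \<open>f\<close>, and then every
element of \<open>P\<close> has a positive multiple which is a multiple of \<open>f\<close>. That makes the rank
at most one, contrary to the existence of two independent elements.

The characterization of the Cantor set (\<open>homeomorphic_cantor_set\<close>) is obtained by cutting the
space repeatedly in two along the given clopen sets. A point then corresponds to the sequence of
halves in which it lies, and reading this sequence as ternary digits \<open>0\<close> and \<open>2\<close> yields the
homeomorphism.
\<close>

section \<open>Ternary expansions\<close>

definition ternary :: "(nat \<Rightarrow> bool) \<Rightarrow> real" where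
  "ternary s = (\<Sum>n. 2 * of_bool (s n) / 3 ^ Suc n)"

lemma summable_ternary: "summable (\<lambda>n. 2 * of_bool (s n) / 3 ^ Suc n :: real)"
proof (rule summable_comparison_test')
  show "summable (\<lambda>n. (1 / 3) ^ n :: real)"
    by (rule summable_geometric) simp
  show "norm (2 * of_bool (s n) / 3 ^ Suc n :: real) \<le> (1 / 3) ^ n" for n
    by (simp add: field_simps)
qed

lemma ternary_unfold: "ternary s = (2 * of_bool (s 0) + ternary (\<lambda>n. s (Suc n))) / 3"
proof -
  have "ternary s = 2 * of_bool (s 0) / 3 + (\<Sum>n. 2 * of_bool (s (Suc n)) / 3 ^ Suc (Suc n))"
    unfolding ternary_def using suminf_split_head[OF summable_ternary[of s]] by simp
  also have "(\<Sum>n. 2 * of_bool (s (Suc n)) / 3 ^ Suc (Suc n) :: real)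
      = ternary (\<lambda>n. s (Suc n)) / 3"
    unfolding ternary_def
    using suminf_divide[OF summable_ternary[of "\<lambda>n. s (Suc n)"], of 3] by (simp add: mult.commute)
  finally show ?thesis
    by (simp add: add_divide_distrib)
qed

lemma ternary_nonneg: "0 \<le> ternary s"
  unfolding ternary_def by (rule suminf_nonneg[OF summable_ternary]) simp

lemma ternary_le_1: "ternary s \<le> 1"
proof -
  have geom: "(\<lambda>n. 2 / 3 * (1 / 3) ^ n :: real) sums (2 / 3 * (1 / (1 - 1 / 3)))"
    by (intro sums_mult geometric_sums) simp
  have "ternary s \<le> (\<Sum>n. 2 / 3 * (1 / 3) ^ n)"
    unfolding ternary_def
    by (rule suminf_le[OF _ summable_ternary sums_summable[OF geom]])
      (simp add: field_simps)
  also have "\<dots> = 1"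
    using sums_unique[OF geom] by simp
  finally show ?thesis .
qed

lemma ternary_inject: "ternary s = ternary t \<longleftrightarrow> s = t"
proof
  have "s n = t n" if "ternary s = ternary t" for n
    using that
  proof (induction n arbitrary: s t)
    case (0 s t)
    then show ?case
      using ternary_nonneg[of "\<lambda>n. s (Suc n)"] ternary_le_1[of "\<lambda>n. s (Suc n)"]
        ternary_nonneg[of "\<lambda>n. t (Suc n)"] ternary_le_1[of "\<lambda>n. t (Suc n)"]
      by (cases "s 0"; cases "t 0") (simp_all add: ternary_unfold[of s] ternary_unfold[of t])
  next
    case (Suc n s t)
    have "s 0 = t 0"
      using Suc.prems ternary_nonneg[of "\<lambda>n. s (Suc n)"] ternary_le_1[of "\<lambda>n. s (Suc n)"]
        ternary_nonneg[of "\<lambda>n. t (Suc n)"] ternary_le_1[of "\<lambda>n. t (Suc n)"]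
      by (cases "s 0"; cases "t 0") (simp_all add: ternary_unfold[of s] ternary_unfold[of t])
    then have "ternary (\<lambda>n. s (Suc n)) = ternary (\<lambda>n. t (Suc n))"
      using Suc.prems by (simp add: ternary_unfold[of s] ternary_unfold[of t])
    then show ?case
      by (rule Suc.IH)
  qed
  then show "s = t" if "ternary s = ternary t"
    using that by blast
qed simp

lemma ternary_close:
  assumes "\<And>j. j < n \<Longrightarrow> s j = t j"
  shows "\<bar>ternary s - ternary t\<bar> \<le> 1 / 3 ^ n"
  using assms
proof (induction n arbitrary: s t)
  case (0 s t)
  then show ?case
    using ternary_nonneg[of s] ternary_le_1[of s] ternary_nonneg[of t] ternary_le_1[of t] by simp
next
  case (Suc n s t)
  have "\<bar>ternary (\<lambda>n. s (Suc n)) - ternary (\<lambda>n. t (Suc n))\<bar> \<le> 1 / 3 ^ n"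
    by (rule Suc.IH) (simp add: Suc.prems)
  moreover have "ternary s - ternary t = (ternary (\<lambda>n. s (Suc n)) - ternary (\<lambda>n. t (Suc n))) / 3"
    using Suc.prems[of 0] by (simp add: ternary_unfold[of s] ternary_unfold[of t] field_simps)
  ultimately show ?case
    by simp
qed

lemma cantor_stage_subset: "cantor_stage k \<subseteq> {0..1}"
  by (induction k) auto

lemma ternary_in_cantor_stage: "ternary s \<in> cantor_stage k"
proof (induction k arbitrary: s)
  case 0
  then show ?case by (simp add: ternary_nonneg ternary_le_1)
next
  case (Suc k)
  show ?case
    using Suc.IH[of "\<lambda>n. s (Suc n)"]
    by (cases "s 0") (auto simp: ternary_unfold[of s] add.commute)
qed

text \<open>
On the two outer thirds of the unit interval this is the inverse of the contractions \<open>x / 3\<close> and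
\<open>(x + 2) / 3\<close>; on the Cantor set it deletes the first ternary digit.
\<close>

definition cantor_shift :: "real \<Rightarrow> real" where
  "cantor_shift x = (if x \<le> 1 / 3 then 3 * x else 3 * x - 2)"

lemma cantor_shift_in_cantor_set:
  assumes "x \<in> cantor_set"
  shows "cantor_shift x \<in> cantor_set"
  unfolding cantor_set_def
proof
  fix k
  have "x \<in> cantor_stage (Suc k)"
    using assms unfolding cantor_set_def by blast
  then obtain y where y: "y \<in> cantor_stage k" "x = y / 3 \<or> x = (y + 2) / 3"
    by auto
  moreover have "0 \<le> y" "y \<le> 1"
    using y(1) cantor_stage_subset by (meson atLeastAtMost_iff subsetD)+
  ultimately have "cantor_shift x = y"
    unfolding cantor_shift_def by (auto split: if_splits)
  with y(1) show "cantor_shift x \<in> cantor_stage k"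
    by simp
qed

text \<open>
The digits of \<open>x\<close> are read off its orbit under \<open>cantor_shift\<close>: a digit is \<open>2\<close> when the orbit is in
the right third. Since the shift triples distances between points with equal first digit, \<open>x\<close> and the
number with these digits are at distance at most \<open>1 / 3 ^ n\<close> for every \<open>n\<close>.
\<close>

lemma ternary_of_cantor_set:
  assumes "x \<in> cantor_set"
  shows "\<exists>s. ternary s = x"
proof -
  define digits where "digits x n \<longleftrightarrow> (cantor_shift ^^ n) x > 1 / 3" for x n
  have digits_Suc: "(\<lambda>n. digits x (Suc n)) = digits (cantor_shift x)" for x
    unfolding digits_def by (simp add: funpow_swap1 del: funpow.simps(2)) (simp add: funpow_swap1)
  have approx: "\<bar>ternary (digits x) - x\<bar> \<le> 1 / 3 ^ n" if "x \<in> cantor_set" for n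
    using that
  proof (induction n arbitrary: x)
    case (0 x)
    have "x \<in> cantor_stage 0"
      using 0 unfolding cantor_set_def by blast
    then show ?case
      using ternary_nonneg[of "digits x"] ternary_le_1[of "digits x"] by (auto simp: abs_le_iff)
  next
    case (Suc n x)
    have "\<bar>ternary (digits (cantor_shift x)) - cantor_shift x\<bar> \<le> 1 / 3 ^ n"
      by (rule Suc.IH[OF cantor_shift_in_cantor_set[OF Suc.prems]])
    moreover have "ternary (digits x) - x
        = (ternary (digits (cantor_shift x)) - cantor_shift x) / 3"
      unfolding ternary_unfold[of "digits x"] digits_Suc
      by (simp add: digits_def cantor_shift_def field_simps)
    ultimately show ?case
      by simp
  qed
  have "\<bar>ternary (digits x) - x\<bar> \<le> 0"
  proof (rule tendsto_lowerbound)
    show "(\<lambda>n. (1 / 3) ^ n :: real) \<longlonglongrightarrow> 0"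
      by (rule LIMSEQ_realpow_zero) auto
    show "\<forall>\<^sub>F n in sequentially. \<bar>ternary (digits x) - x\<bar> \<le> (1 / 3) ^ n"
      using approx[OF assms] by (simp add: power_one_over)
  qed simp
  then show ?thesis
    by auto
qed

lemma range_ternary: "range ternary = cantor_set"
  using ternary_in_cantor_stage ternary_of_cantor_set unfolding cantor_set_def by blast

section \<open>A topological characterization of the Cantor set\<close>

text \<open>
The sets \<open>A k\<close> are used one after the other to cut the space in two. The Hausdorff property is a
consequence of their separating points.
\<close>

locale perfect_clopen_separated =
  fixes X :: "'a topology" and A :: "nat \<Rightarrow> 'a set"
  assumes compact: "compact_space X"
    and nonempty: "topspace X \<noteq> {}"
    and open_A: "\<And>k. openin X (A k)"
    and closed_A: "\<And>k. closedin X (A k)"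
    and separated: "\<And>x y. \<lbrakk>x \<in> topspace X; y \<in> topspace X; x \<noteq> y\<rbrakk> \<Longrightarrow> \<exists>k. x \<in> A k \<longleftrightarrow> y \<notin> A k"
    and no_isolated: "\<And>x. \<not> openin X {x}"
begin

definition splits :: "'a set \<Rightarrow> nat \<Rightarrow> bool" where
  "splits C k \<longleftrightarrow> (\<exists>x\<in>C. \<exists>y\<in>C. x \<in> A k \<and> y \<notin> A k)"

text \<open>
Every cut is made along the first \<open>A k\<close> that divides the cell. Hence no \<open>A k\<close> is passed over while
it still divides a cell, which is why the cells shrink to points.
\<close>

definition first_split :: "'a set \<Rightarrow> nat" where
  "first_split C = (LEAST k. splits C k)"

definition half :: "'a set \<Rightarrow> bool \<Rightarrow> 'a set" where
  "half C b = {x \<in> C. x \<in> A (first_split C) \<longleftrightarrow> b}"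

text \<open>
The same cells are described twice, from a sequence of halves and from a point, because
the halves chosen by a point can only be read off once its cells are known.
\<close>

primrec node :: "(nat \<Rightarrow> bool) \<Rightarrow> nat \<Rightarrow> 'a set" where
  "node s 0 = topspace X"
| "node s (Suc n) = half (node s n) (s n)"

primrec cell :: "'a \<Rightarrow> nat \<Rightarrow> 'a set" where
  "cell x 0 = topspace X"
| "cell x (Suc n) = half (cell x n) (x \<in> A (first_split (cell x n)))"

definition itinerary :: "'a \<Rightarrow> nat \<Rightarrow> bool" where
  "itinerary x n \<longleftrightarrow> x \<in> A (first_split (cell x n))"

text \<open>
A nonempty open cell has at least two points, there being no isolated ones, and some \<open>A k\<close>
separates them.
\<close>

lemma splits_first_split:
  assumes "openin X C" "C \<noteq> {}"
  shows "splits C (first_split C)"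
proof -
  obtain x where x: "x \<in> C"
    using assms(2) by blast
  obtain y where y: "y \<in> C" "y \<noteq> x"
    using assms(1) x no_isolated[of x] by (cases "C = {x}") auto
  have "\<exists>k. x \<in> A k \<longleftrightarrow> y \<notin> A k"
    using separated[of x y] x y openin_subset[OF assms(1)] by blast
  then have "\<exists>k. splits C k"
    unfolding splits_def using x y by blast
  then show ?thesis
    unfolding first_split_def by (rule LeastI_ex)
qed

lemma half_clopen:
  assumes "openin X C" "closedin X C"
  shows "openin X (half C b)" "closedin X (half C b)"
proof -
  have "half C b = (if b then C \<inter> A (first_split C) else C - A (first_split C))"
    unfolding half_def by auto
  then show "openin X (half C b)" "closedin X (half C b)"
    using assms open_A closed_A by (auto simp: openin_diff closedin_diff)
qed

lemma half_nonempty: "openin X C \<Longrightarrow> C \<noteq> {} \<Longrightarrow> half C b \<noteq> {}"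
  using splits_first_split[of C] unfolding splits_def half_def by (cases b) auto

lemma node_clopen: "openin X (node s n) \<and> closedin X (node s n) \<and> node s n \<noteq> {}"
  using nonempty by (induction n) (simp_all add: half_clopen half_nonempty)

lemma node_Suc_subset: "node s (Suc n) \<subseteq> node s n"
  by (auto simp: half_def)

text \<open>
A set that divides a half divides the whole as well, and the set just used for the cut divides
neither half.
\<close>

lemma first_split_less_half:
  assumes "openin X C" "closedin X C" "C \<noteq> {}"
  shows "first_split C < first_split (half C b)"
proof -
  let ?k = "first_split (half C b)"
  have "splits (half C b) ?k"
    using assms by (intro splits_first_split half_clopen half_nonempty)
  then obtain x y where xy: "x \<in> half C b" "y \<in> half C b" "x \<in> A ?k" "y \<notin> A ?k"
    unfolding splits_def by blast
  then have "splits C ?k"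
    unfolding splits_def half_def by blast
  then have "first_split C \<le> ?k"
    unfolding first_split_def by (rule Least_le)
  moreover have "first_split C \<noteq> ?k"
    using xy unfolding half_def by auto
  ultimately show ?thesis
    by simp
qed

lemma le_first_split_node: "n \<le> first_split (node s n)"
proof (induction n)
  case (Suc n)
  then show ?case
    using first_split_less_half[of "node s n" "s n"] node_clopen[of s n] by simp
qed simp

text \<open>
If \<open>A k\<close> separated two points that stay together forever, then it would divide all the cells, so that
the first dividing index would never exceed \<open>k\<close>; but this index grows strictly along the cells.
\<close>

lemma node_determines_point:
  assumes "\<And>n. x \<in> node s n" "\<And>n. y \<in> node s n"
  shows "x = y"
proof (rule ccontr)
  assume "x \<noteq> y"
  then obtain k where k: "x \<in> A k \<longleftrightarrow> y \<notin> A k"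
    using separated[of x y] assms[of 0] by auto
  have "splits (node s (Suc k)) k"
    unfolding splits_def using k assms by blast
  then have "first_split (node s (Suc k)) \<le> k"
    unfolding first_split_def by (rule Least_le)
  then show False
    using le_first_split_node[of "Suc k" s] by simp
qed

lemma node_itinerary: "node (itinerary x) n = cell x n"
  by (induction n) (simp_all add: itinerary_def)

lemma in_own_cell: "x \<in> topspace X \<Longrightarrow> x \<in> cell x n"
  by (induction n) (simp_all add: half_def)

lemma cell_eq_node: "x \<in> node s n \<Longrightarrow> cell x n = node s n"
  by (induction n) (auto simp: half_def)

lemma itinerary_eq:
  assumes "x \<in> node s n" "j < n"
  shows "itinerary x j = s j"
proof -
  have "node s n \<subseteq> node s (Suc j)"
    using assms(2) lift_Suc_antimono_le[of "node s", OF node_Suc_subset] by (meson Suc_leI)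
  then have "x \<in> node s (Suc j)"
    using assms(1) by blast
  moreover then have "cell x j = node s j"
    using node_Suc_subset cell_eq_node by blast
  ultimately show ?thesis
    by (simp add: itinerary_def half_def)
qed

lemma inj_on_itinerary: "inj_on itinerary (topspace X)"
  by (intro inj_onI) (metis in_own_cell node_determines_point node_itinerary)

text \<open>
By compactness, nested nonempty closed cells have a
common point.
\<close>

lemma itinerary_surj: "\<exists>x\<in>topspace X. itinerary x = s"
proof -
  have "decseq (node s)"
    by (intro decseq_SucI node_Suc_subset)
  then have "(\<Inter>n. node s n) \<noteq> {}"
    using compact_space_imp_nest[OF compact, of "node s"] node_clopen by blast
  then obtain x where x: "\<And>n. x \<in> node s n"
    by blast
  then have "itinerary x = s"
    using itinerary_eq by blast
  then show ?thesis
    using x[of 0] by auto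
qed

text \<open>
All points of the open set \<open>cell x n\<close> share the first \<open>n\<close> digits of \<open>x\<close>.
\<close>

lemma continuous_ternary_itinerary:
  "continuous_map X euclideanreal (\<lambda>x. ternary (itinerary x))"
  unfolding continuous_map_def
proof (intro conjI allI impI)
  fix U :: "real set"
  assume "openin euclideanreal U"
  then have U: "open U"
    by simp
  show "openin X {x \<in> topspace X. ternary (itinerary x) \<in> U}"
  proof (subst openin_subopen, intro ballI)
    fix x
    assume "x \<in> {x \<in> topspace X. ternary (itinerary x) \<in> U}"
    then have x: "x \<in> topspace X" "ternary (itinerary x) \<in> U"
      by auto
    obtain e where e: "e > 0" "ball (ternary (itinerary x)) e \<subseteq> U"
      using U x(2) open_contains_ball by blast
    obtain n where n: "(1 / 3) ^ n < e"
      using real_arch_pow_inv[OF e(1), of "1 / 3"] by auto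
    have "ternary (itinerary y) \<in> U" if "y \<in> cell x n" for y
    proof -
      have "itinerary x j = itinerary y j" if "j < n" for j
        using itinerary_eq[of y "itinerary x" n j] that \<open>y \<in> cell x n\<close> node_itinerary by simp
      then have "\<bar>ternary (itinerary x) - ternary (itinerary y)\<bar> \<le> 1 / 3 ^ n"
        by (rule ternary_close)
      then have "ternary (itinerary y) \<in> ball (ternary (itinerary x)) e"
        using n by (simp add: dist_real_def power_one_over)
      with e(2) show ?thesis
        by blast
    qed
    moreover have "openin X (cell x n)"
      using node_clopen[of "itinerary x" n] node_itinerary by simp
    ultimately show "\<exists>T. openin X T \<and> x \<in> T \<and> T \<subseteq> {x \<in> topspace X. ternary (itinerary x) \<in> U}"
      using in_own_cell[OF x(1)] openin_subset by blast
  qed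
qed simp

theorem homeomorphic_cantor_set: "X homeomorphic_space top_of_set cantor_set"
proof -
  let ?f = "\<lambda>x. ternary (itinerary x)"
  have image: "?f ` topspace X = cantor_set"
    using itinerary_surj unfolding range_ternary[symmetric] by (auto simp: image_iff) metis
  have "homeomorphic_map X (top_of_set cantor_set) ?f"
  proof (rule continuous_imp_homeomorphic_map[OF _ compact])
    show "continuous_map X (top_of_set cantor_set) ?f"
      using continuous_ternary_itinerary image
      by (auto simp: continuous_map_in_subtopology)
    show "inj_on ?f (topspace X)"
      using inj_on_itinerary by (simp add: inj_on_def ternary_inject)
  qed (use image in \<open>simp_all add: Hausdorff_space_subtopology\<close>)
  then show ?thesis
    unfolding homeomorphic_space by blast
qed

end

section \<open>Positive cones\<close>

primrec (in monoid_add) nmul :: "nat \<Rightarrow> 'a \<Rightarrow> 'a" where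
  "nmul 0 g = 0"
| "nmul (Suc k) g = g + nmul k g"

lemma nmul_add: "nmul (j + k) g = nmul j g + nmul k g"
  by (induction j) (simp_all add: add.assoc)

lemma nmul_nmul: "nmul j (nmul k g) = nmul (j * k) g"
  by (induction j) (simp_all add: nmul_add)

lemma nmul_minus: "nmul k (- g) = - nmul k (g::'a::ab_group_add)"
  by (induction k) simp_all

lemma nmul_diff_right: "nmul k (g - h) = nmul k g - nmul k (h::'a::ab_group_add)"
  by (induction k) simp_all

class torsion_free_ab_group = ab_group_add +
  assumes torsion_free: "\<lbrakk>k > 0; nmul k g = 0\<rbrakk> \<Longrightarrow> g = 0"

definition zero_free_subsemigroup :: "'a::monoid_add set \<Rightarrow> bool" where
  "zero_free_subsemigroup S \<longleftrightarrow> 0 \<notin> S \<and> (\<forall>x\<in>S. \<forall>y\<in>S. x + y \<in> S)"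

definition positive_cone :: "'a::ab_group_add set \<Rightarrow> bool" where
  "positive_cone P \<longleftrightarrow> zero_free_subsemigroup P \<and> (\<forall>x. x \<noteq> 0 \<longrightarrow> x \<in> P \<or> - x \<in> P)"

text \<open>
If \<open>S\<close> is a subsemigroup, this is the subsemigroup generated by \<open>S\<close> and \<open>g\<close>.
\<close>

definition adjoin :: "'a::ab_group_add set \<Rightarrow> 'a \<Rightarrow> 'a set" where
  "adjoin S g = S \<union> {s + nmul k g | s k. s \<in> insert 0 S \<and> k > 0}"

lemma adjoin_subset: "S \<subseteq> adjoin S g"
  unfolding adjoin_def by blast

lemma in_adjoin: "g \<in> adjoin S g"
proof -
  have "g = 0 + nmul (Suc 0) g"
    by simp
  then show ?thesis
    unfolding adjoin_def by blast
qed

lemma adjoin_cases: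
  assumes "x \<in> adjoin S g"
  obtains s k where "s \<in> insert 0 S" "s \<in> S \<or> k > 0" "x = s + nmul k g"
proof (cases "x \<in> S")
  case True
  show ?thesis
    by (rule that[of x 0]) (simp_all add: True)
next
  case False
  then show ?thesis
    using assms that unfolding adjoin_def by blast
qed

lemma nmul_in_subsemigroup:
  assumes "zero_free_subsemigroup S" "g \<in> S" "k > 0"
  shows "nmul k g \<in> S"
  using assms(3)
proof (induction k rule: nat_induct_non_zero)
  case 1
  then show ?case using assms(2) by simp
next
  case (Suc k)
  then show ?case using assms(1,2) unfolding zero_free_subsemigroup_def by simp
qed

lemma zero_free_subsemigroup_adjoin:
  assumes S: "zero_free_subsemigroup S" and g: "\<And>k. k > 0 \<Longrightarrow> - nmul k g \<notin> insert 0 S"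
  shows "zero_free_subsemigroup (adjoin S g)"
  unfolding zero_free_subsemigroup_def
proof (intro conjI ballI notI)
  assume "0 \<in> adjoin S g"
  then obtain s k where sk: "s \<in> insert 0 S" "s \<in> S \<or> k > 0" "0 = s + nmul k g"
    by (rule adjoin_cases)
  then have "- nmul k g = s"
    by (metis eq_neg_iff_add_eq_0)
  with sk g[of k] S show False
    unfolding zero_free_subsemigroup_def by (cases "k = 0") auto
next
  fix x y
  assume "x \<in> adjoin S g" "y \<in> adjoin S g"
  then obtain s k t j where
    x: "s \<in> insert 0 S" "s \<in> S \<or> k > 0" "x = s + nmul k g" and
    y: "t \<in> insert 0 S" "t \<in> S \<or> j > 0" "y = t + nmul j g"
    by (elim adjoin_cases)
  have "s + t \<in> insert 0 S" "s \<in> S \<or> t \<in> S \<Longrightarrow> s + t \<in> S"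
    using x(1) y(1) S unfolding zero_free_subsemigroup_def by auto
  moreover have "x + y = (s + t) + nmul (k + j) g"
    by (simp add: x y nmul_add algebra_simps)
  ultimately show "x + y \<in> adjoin S g"
    using x(2) y(2) unfolding adjoin_def by (cases "k + j = 0") auto
qed

text \<open>
A relation \<open>s + nmul k g = 0\<close> is the only thing that can prevent \<open>g\<close> from becoming positive, and
torsion-freeness excludes the case \<open>s = 0\<close>.
\<close>

lemma adjoin_obstruction:
  fixes g :: "'a::torsion_free_ab_group"
  assumes "zero_free_subsemigroup S" "g \<noteq> 0" "\<not> zero_free_subsemigroup (adjoin S g)"
  shows "\<exists>k>0. - nmul k g \<in> S"
proof -
  obtain k where k: "k > 0" "- nmul k g \<in> insert 0 S"
    using zero_free_subsemigroup_adjoin[OF assms(1)] assms(3) by blast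
  have "nmul k g \<noteq> 0"
    using torsion_free[OF k(1)] assms(2) by blast
  with k show ?thesis
    by (intro exI[of _ k]) simp
qed

text \<open>
A maximal subsemigroup \<open>M\<close> avoiding \<open>0\<close> is a positive cone: if it contained neither \<open>g\<close> nor
\<open>- g\<close>, then by maximality neither could be adjoined, so \<open>M\<close> would contain a negative and a
positive multiple of \<open>g\<close>, and therefore also a sum of their multiples which is \<open>0\<close>.
\<close>

lemma positive_cone_extension:
  fixes S :: "'a::torsion_free_ab_group set"
  assumes S: "zero_free_subsemigroup S"
  obtains P where "positive_cone P" "S \<subseteq> P"
proof -
  let ?Z = "{T. zero_free_subsemigroup T \<and> S \<subseteq> T}"
  have "\<exists>M\<in>?Z. \<forall>T\<in>?Z. M \<subseteq> T \<longrightarrow> T = M"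
  proof (rule subset_Zorn_nonempty)
    show "?Z \<noteq> {}"
      using S by blast
    fix C
    assume C: "C \<noteq> {}" "subset.chain ?Z C"
    have "x + y \<in> \<Union>C" if xy: "x \<in> \<Union>C" "y \<in> \<Union>C" for x y
    proof -
      obtain T1 T2 where T12: "T1 \<in> C" "x \<in> T1" "T2 \<in> C" "y \<in> T2"
        using xy by blast
      then have "T1 \<subseteq> T2 \<or> T2 \<subseteq> T1"
        using C(2) unfolding subset_chain_def by blast
      then obtain T where "T \<in> C" "x \<in> T" "y \<in> T"
        using T12 by blast
      then show ?thesis
        using C(2) unfolding subset_chain_def zero_free_subsemigroup_def by blast
    qed
    moreover have "0 \<notin> \<Union>C" "S \<subseteq> \<Union>C"
      using C unfolding subset_chain_def zero_free_subsemigroup_def by blast+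
    ultimately show "\<Union>C \<in> ?Z"
      unfolding zero_free_subsemigroup_def by blast
  qed
  then obtain M where M: "zero_free_subsemigroup M" "S \<subseteq> M"
    and maximal: "\<And>T. zero_free_subsemigroup T \<Longrightarrow> M \<subseteq> T \<Longrightarrow> T = M"
    by auto
  have power_in: "\<exists>k>0. - nmul k g \<in> M" if "g \<noteq> 0" "g \<notin> M" for g
  proof (rule adjoin_obstruction[OF M(1) that(1)], rule notI)
    assume "zero_free_subsemigroup (adjoin M g)"
    then have "adjoin M g = M"
      using maximal adjoin_subset by blast
    then show False
      using in_adjoin that(2) by blast
  qed
  have "g \<in> M \<or> - g \<in> M" if nonzero: "g \<noteq> 0" for g
  proof (rule ccontr)
    assume "\<not> ?thesis"
    then obtain j k where jk: "j > 0" "k > 0" "- nmul j g \<in> M" "- nmul k (- g) \<in> M"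
      using power_in[of g] power_in[of "- g"] nonzero by auto
    have "nmul k (- nmul j g) \<in> M" "nmul j (- nmul k (- g)) \<in> M"
      using jk by (simp_all add: nmul_in_subsemigroup M(1))
    then have "nmul k (- nmul j g) + nmul j (- nmul k (- g)) \<in> M"
      using M(1) unfolding zero_free_subsemigroup_def by blast
    moreover have "nmul k (- nmul j g) + nmul j (- nmul k (- g)) = 0"
      by (simp add: nmul_minus nmul_nmul mult.commute)
    ultimately show False
      using M(1) unfolding zero_free_subsemigroup_def by simp
  qed
  then have "positive_cone M"
    using M(1) unfolding positive_cone_def by blast
  then show thesis
    using M(2) that by blast
qed

text \<open>
For a finite subset \<open>F\<close> of the positive cone \<open>P\<close> this says that the basic open set of all orders in
which the elements of \<open>F\<close> are positive is the singleton of the order with cone \<open>P\<close>.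
\<close>

definition isolates :: "'a::ab_group_add set \<Rightarrow> 'a set \<Rightarrow> bool" where
  "isolates P F \<longleftrightarrow> (\<forall>Q. positive_cone Q \<and> F \<subseteq> Q \<longrightarrow> Q = P)"

lemma positive_coneD:
  assumes "positive_cone P"
  shows "zero_free_subsemigroup P" "0 \<notin> P"
    "\<And>x y. x \<in> P \<Longrightarrow> y \<in> P \<Longrightarrow> x + y \<in> P"
    "\<And>x. x \<noteq> 0 \<Longrightarrow> x \<in> P \<or> - x \<in> P"
  using assms unfolding positive_cone_def zero_free_subsemigroup_def by auto

lemma positive_cone_minus: "positive_cone P \<Longrightarrow> x \<in> P \<Longrightarrow> - x \<notin> P"
  using positive_coneD(2,3)[of P] by (metis add.right_inverse)

text \<open>
The main way to exploit isolation: no positive cone contains \<open>S\<close> and an element \<open>g\<close> outside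
\<open>P\<close>, so by the extension theorem something in \<open>T\<close> must prevent \<open>g\<close> from being adjoined.
\<close>

lemma isolates_imp_multiple_in:
  fixes P :: "'a::torsion_free_ab_group set"
  assumes iso: "isolates P S" and S: "zero_free_subsemigroup T" "S \<subseteq> T"
    and g: "g \<noteq> 0" "g \<notin> P"
  shows "\<exists>k>0. - nmul k g \<in> T"
proof (rule adjoin_obstruction[OF S(1) g(1)], rule notI)
  assume "zero_free_subsemigroup (adjoin T g)"
  then obtain Q where "positive_cone Q" "adjoin T g \<subseteq> Q"
    using positive_cone_extension by blast
  moreover then have "S \<subseteq> Q" "g \<in> Q"
    using adjoin_subset[of T g] in_adjoin[of g T] S(2) by auto
  ultimately show False
    using iso g(2) unfolding isolates_def by blast
qed

text \<open>
Suppose that a cone \<open>Q \<noteq> P\<close> contains \<open>F - {f}\<close>; then \<open>- f \<in> Q\<close>, since \<open>Q\<close> does not contain \<open>F\<close>. As \<open>F\<close> isolates \<open>P\<close>, the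
element \<open>h - f \<notin> P\<close> cannot be adjoined to the subsemigroup generated by \<open>P \<inter> Q\<close> and \<open>f\<close>, which
contains \<open>F\<close>. This means that \<open>k f = s + k h + j f\<close> for some \<open>k > 0\<close>, \<open>j \<ge> 0\<close> and \<open>s\<close> in
\<open>P \<inter> Q\<close> or zero. If \<open>j \<ge> k\<close>, this writes \<open>0\<close> as an element of \<open>P\<close>. If \<open>j < k\<close>, the positive
multiple \<open>(k - j) f\<close> equals \<open>s + k h \<in> Q\<close>, contrary to \<open>- f \<in> Q\<close>.
\<close>

lemma isolates_remove_larger:
  fixes P :: "'a::torsion_free_ab_group set"
  assumes P: "positive_cone P" "F \<subseteq> P" and iso: "isolates P F"
    and f: "f \<in> F" "h \<in> F" "f - h \<in> P"
  shows "isolates P (F - {f})"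
  unfolding isolates_def
proof (intro allI impI, elim conjE, rule ccontr)
  fix Q
  assume Q: "positive_cone Q" "F - {f} \<subseteq> Q" "Q \<noteq> P"
  have fh: "f \<noteq> h"
    using f(3) positive_coneD(2)[OF P(1)] by auto
  have "f \<in> P" "h \<in> P" "h \<in> Q"
    using f P(2) Q(2) fh by auto
  have "\<not> F \<subseteq> Q"
    using iso Q(1,3) unfolding isolates_def by blast
  then have "f \<notin> Q"
    using Q(2) by blast
  moreover have "f \<noteq> 0"
    using \<open>f \<in> P\<close> positive_coneD(2)[OF P(1)] by auto
  ultimately have "- f \<in> Q"
    using positive_coneD(4)[OF Q(1)] by blast
  let ?T = "adjoin (P \<inter> Q) f"
  have meet: "zero_free_subsemigroup (P \<inter> Q)"
    using positive_coneD(2,3)[OF P(1)] positive_coneD(2,3)[OF Q(1)]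
    unfolding zero_free_subsemigroup_def by blast
  have "- nmul k f \<notin> insert 0 (P \<inter> Q)" if "k > 0" for k
  proof -
    have "nmul k f \<in> P"
      using nmul_in_subsemigroup[OF positive_coneD(1)[OF P(1)] \<open>f \<in> P\<close> that] .
    then show ?thesis
      using positive_cone_minus[OF P(1)] positive_coneD(2)[OF P(1)] by auto
  qed
  then have "zero_free_subsemigroup ?T"
    by (rule zero_free_subsemigroup_adjoin[OF meet])
  moreover have "F \<subseteq> ?T"
    using P(2) Q(2) adjoin_subset[of "P \<inter> Q" f] in_adjoin[of f "P \<inter> Q"] by auto
  moreover have "h - f \<notin> P"
    using positive_cone_minus[OF P(1) f(3)] by simp
  ultimately obtain k where k: "k > 0" "- nmul k (h - f) \<in> ?T"
    using isolates_imp_multiple_in[OF iso, of ?T "h - f"] fh by auto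
  then obtain s j where sj: "s \<in> insert 0 (P \<inter> Q)" "- nmul k (h - f) = s + nmul j f"
    by (elim adjoin_cases)
  have kh: "nmul k h \<in> P" "nmul k h \<in> Q"
    using \<open>h \<in> P\<close> \<open>h \<in> Q\<close> k(1) P(1) Q(1) by (simp_all add: nmul_in_subsemigroup positive_coneD(1))
  then have skh: "s + nmul k h \<in> P" "s + nmul k h \<in> Q"
    using sj(1) positive_coneD(3)[OF P(1)] positive_coneD(3)[OF Q(1)] by auto
  have eq: "nmul k f = s + nmul k h + nmul j f"
    using sj(2) by (simp add: nmul_diff_right algebra_simps)
  show False
  proof (cases "k \<le> j")
    case True
    then have "s + nmul k h + nmul (j - k) f = 0"
      using eq nmul_add[of k "j - k" f] by (simp add: algebra_simps)
    moreover have "s + nmul k h + nmul (j - k) f \<in> P"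
      using skh(1) nmul_in_subsemigroup[OF positive_coneD(1)[OF P(1)] \<open>f \<in> P\<close>, of "j - k"]
        positive_coneD(3)[OF P(1)] by (cases "j - k = 0") auto
    ultimately show False
      using positive_coneD(2)[OF P(1)] by simp
  next
    case False
    then have "nmul (k - j) f = s + nmul k h"
      using eq nmul_add[of j "k - j" f] by (simp add: algebra_simps)
    moreover have "- nmul (k - j) f \<in> Q"
      using nmul_in_subsemigroup[OF positive_coneD(1)[OF Q(1)] \<open>- f \<in> Q\<close>, of "k - j"] False
      by (simp add: nmul_minus)
    ultimately show False
      using positive_cone_minus[OF Q(1) skh(2)] by simp
  qed
qed

text \<open>
Any two distinct elements of \<open>F\<close> are comparable, so the larger one can be discarded until at most
one is left.
\<close>

lemma isolates_singleton:
  fixes P :: "'a::torsion_free_ab_group set"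
  assumes P: "positive_cone P" and F: "finite F" "F \<subseteq> P" "isolates P F" and "P \<noteq> {}"
  shows "\<exists>f\<in>P. isolates P {f}"
  using F
proof (induction rule: finite_psubset_induct)
  case (psubset F)
  show ?case
  proof (cases "\<exists>f\<in>F. \<exists>h\<in>F. f \<noteq> h")
    case True
    then obtain f h where fh: "f \<in> F" "h \<in> F" "f - h \<in> P"
      using positive_coneD(4)[OF P] by (metis eq_iff_diff_eq_0 minus_diff_eq)
    have "isolates P (F - {f})"
      by (rule isolates_remove_larger[OF P psubset.prems fh])
    then show ?thesis
      using psubset.IH[of "F - {f}"] psubset.prems(1) fh(1) by blast
  next
    case False
    obtain f where "f \<in> P" "F \<subseteq> {f}"
      using False psubset.prems(1) \<open>P \<noteq> {}\<close> by (metis ex_in_conv insert_iff subsetD subsetI)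
    then show ?thesis
      using psubset.prems(2) unfolding isolates_def by (meson subset_trans)
  qed
qed

text \<open>
If \<open>{f}\<close> isolates \<open>P\<close>, then every \<open>g \<in> P\<close> satisfies \<open>nmul k g = nmul j f\<close> for some positive
\<open>j\<close> and \<open>k\<close>, since \<open>- g\<close> cannot be made positive together with \<open>f\<close>. Applied to \<open>x\<close> and
\<open>y\<close>, up to sign, this gives a dependence between them. With natural multiples only, independence
has to be stated for both signs.
\<close>

lemma not_isolates_finite:
  fixes P :: "'a::torsion_free_ab_group set" and x y :: 'a
  assumes xy: "x \<noteq> 0" "y \<noteq> 0"
    and independent: "\<And>j k. \<lbrakk>j > 0; k > 0\<rbrakk> \<Longrightarrow> nmul j x \<noteq> nmul k y \<and> nmul j x \<noteq> - nmul k y"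
    and P: "positive_cone P" and F: "finite F" "F \<subseteq> P"
  shows "\<not> isolates P F"
proof
  assume "isolates P F"
  moreover have "P \<noteq> {}"
    using positive_coneD(4)[OF P xy(1)] by auto
  ultimately obtain f where f: "f \<in> P" "isolates P {f}"
    using isolates_singleton[OF P F] by blast
  let ?T = "{nmul k f | k. k > 0}"
  have T: "zero_free_subsemigroup ?T"
    unfolding zero_free_subsemigroup_def
  proof (intro conjI ballI notI)
    assume "0 \<in> ?T"
    then obtain k where k: "k > 0" "0 = nmul k f"
      by blast
    then have "0 \<in> P"
      using nmul_in_subsemigroup[OF positive_coneD(1)[OF P] f(1)] by metis
    then show False
      using positive_coneD(2)[OF P] by blast
  next
    fix u v
    assume "u \<in> ?T" "v \<in> ?T"
    then obtain j k where "j > 0" "k > 0" "u = nmul j f" "v = nmul k f"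
      by blast
    then show "u + v \<in> ?T"
      using nmul_add[of j k f] by (metis (mono_tags, lifting) add_pos_pos mem_Collect_eq)
  qed
  have commensurable: "\<exists>j k. j > 0 \<and> k > 0 \<and> nmul k g = nmul j f" if "g \<in> P" for g
  proof -
    have "f = nmul (Suc 0) f"
      by simp
    then have "f \<in> ?T"
      by blast
    moreover have "- g \<noteq> 0" "- g \<notin> P"
      using that positive_coneD(2)[OF P] positive_cone_minus[OF P] by auto
    ultimately obtain k where "k > 0" "- nmul k (- g) \<in> ?T"
      using isolates_imp_multiple_in[OF f(2) T, of "- g"] by blast
    then show ?thesis
      by (auto simp: nmul_minus)
  qed
  \<comment> \<open>the signs are chosen so that both elements are positive\<close>
  obtain x' y' where x'y': "x' \<in> P" "y' \<in> P" "x' = x \<or> x' = - x" "y' = y \<or> y' = - y"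
    using positive_coneD(4)[OF P] xy by metis
  obtain a b c d where abcd: "a > 0" "b > 0" "c > 0" "d > 0"
    "nmul b x' = nmul a f" "nmul d y' = nmul c f"
    using commensurable x'y'(1,2) by metis
  have "nmul (c * b) x' = nmul (a * d) y'"
    by (metis abcd(5,6) mult.commute nmul_nmul)
  then have "nmul (c * b) x = nmul (a * d) y \<or> nmul (c * b) x = - nmul (a * d) y"
    using x'y'(3,4) by (auto simp: nmul_minus minus_equation_iff)
  then show False
    using independent[of "c * b" "a * d"] abcd by simp
qed

section \<open>The space of left orders\<close>

definition cone_of :: "'a::ab_group_add rel \<Rightarrow> 'a set" where
  "cone_of r = {g. (0, g) \<in> r}"

definition order_of :: "'a::ab_group_add set \<Rightarrow> 'a rel" where
  "order_of P = {(a, b). b - a \<in> P}"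

lemma left_order_iff:
  "left_order r \<longleftrightarrow> (\<forall>a. (a, a) \<notin> r) \<and> (\<forall>a b c. (a, b) \<in> r \<longrightarrow> (b, c) \<in> r \<longrightarrow> (a, c) \<in> r)
    \<and> (\<forall>a b. a \<noteq> b \<longrightarrow> (a, b) \<in> r \<or> (b, a) \<in> r) \<and> (\<forall>a b c. (a, b) \<in> r \<longrightarrow> (c + a, c + b) \<in> r)"
proof -
  have "irrefl r \<longleftrightarrow> (\<forall>a. (a, a) \<notin> r)"
    by (simp add: irrefl_def)
  moreover have "trans r \<longleftrightarrow> (\<forall>a b c. (a, b) \<in> r \<longrightarrow> (b, c) \<in> r \<longrightarrow> (a, c) \<in> r)"
    by (rule trans_def)
  moreover have "total r \<longleftrightarrow> (\<forall>a b. a \<noteq> b \<longrightarrow> (a, b) \<in> r \<or> (b, a) \<in> r)"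
    by (simp add: total_on_def)
  ultimately show ?thesis
    unfolding left_order_def strict_linear_order_on_def by argo
qed

lemma left_orderD:
  assumes "left_order r"
  shows "(a, a) \<notin> r"
    and "\<lbrakk>(a, b) \<in> r; (b, c) \<in> r\<rbrakk> \<Longrightarrow> (a, c) \<in> r"
    and "a \<noteq> b \<Longrightarrow> (a, b) \<in> r \<or> (b, a) \<in> r"
    and "(a, b) \<in> r \<Longrightarrow> (c + a, c + b) \<in> r"
proof -
  have r: "irrefl r" "trans r" "total r" and translate: "\<And>a b c. (a, b) \<in> r \<Longrightarrow> (c + a, c + b) \<in> r"
    using assms unfolding left_order_def strict_linear_order_on_def by iprover+
  show "(a, a) \<notin> r" 
    using r(1) by (simp add: irrefl_def)
  show "\<lbrakk>(a, b) \<in> r; (b, c) \<in> r\<rbrakk> \<Longrightarrow> (a, c) \<in> r"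
    by (rule transD[OF r(2)])
  show "a \<noteq> b \<Longrightarrow> (a, b) \<in> r \<or> (b, a) \<in> r"
    using r(3) by (simp add: total_on_def)
  show "(a, b) \<in> r \<Longrightarrow> (c + a, c + b) \<in> r"
    by (rule translate)
qed

lemma left_order_less_iff:
  fixes r :: "'a::ab_group_add rel"
  assumes "left_order r"
  shows "(a, b) \<in> r \<longleftrightarrow> (0, b - a) \<in> r"
proof
  show "(0, b - a) \<in> r" if "(a, b) \<in> r"
    using left_orderD(4)[OF assms that, of "- a"] by simp
  show "(a, b) \<in> r" if "(0, b - a) \<in> r"
    using left_orderD(4)[OF assms that, of a] by simp
qed

lemma order_of_cone_of:
  assumes "left_order r"
  shows "order_of (cone_of r) = r"
proof -
  have "(a, b) \<in> order_of (cone_of r) \<longleftrightarrow> (a, b) \<in> r" for a b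
    unfolding order_of_def cone_of_def left_order_less_iff[OF assms, of a b] by simp
  then show ?thesis
    by auto
qed

lemma cone_of_order_of: "cone_of (order_of P) = P"
  unfolding order_of_def cone_of_def by simp

lemma positive_cone_cone_of:
  assumes "left_order r"
  shows "positive_cone (cone_of r)"
  unfolding positive_cone_def zero_free_subsemigroup_def cone_of_def mem_Collect_eq
proof (intro conjI ballI allI impI)
  show "(0, 0) \<notin> r"
    by (rule left_orderD(1)[OF assms])
  show "(0, x + y) \<in> r" if "x \<in> {g. (0, g) \<in> r}" "y \<in> {g. (0, g) \<in> r}" for x y
    using that left_orderD(4)[OF assms, of 0 y x] left_orderD(2)[OF assms, of 0 x "x + y"] by simp
  show "(0, x) \<in> r \<or> (0, - x) \<in> r" if "x \<noteq> 0" for x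
    using that left_order_less_iff[OF assms, of x 0] left_orderD(3)[OF assms, of 0 x] by simp
qed

lemma left_order_order_of:
  assumes "positive_cone P"
  shows "left_order (order_of P)"
  unfolding left_order_iff order_of_def
proof (intro conjI allI impI)
  fix a b c
  show "(a, a) \<notin> {(a, b). b - a \<in> P}"
    using positive_coneD(2)[OF assms] by simp
  show "(a, c) \<in> {(a, b). b - a \<in> P}"
    if "(a, b) \<in> {(a, b). b - a \<in> P}" "(b, c) \<in> {(a, b). b - a \<in> P}"
    using that positive_coneD(3)[OF assms, of "b - a" "c - b"] by simp
  show "(a, b) \<in> {(a, b). b - a \<in> P} \<or> (b, a) \<in> {(a, b). b - a \<in> P}" if "a \<noteq> b"
    using that positive_coneD(4)[OF assms, of "b - a"] by simp
qed simp

text \<open>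
The membership functions of left orders form a closed, hence compact, subset of the product of
two-point spaces indexed by pairs of group elements, and the space of left orders is a continuous
image of it.
\<close>

lemma compact_space_left_order_topology:
  "compact_space (left_order_topology :: 'a::group_add rel topology)"
proof -
  let ?K = "{u :: 'a \<times> 'a \<Rightarrow> bool. left_order {p. u p}}"
  have open_eval: "open {u :: 'a \<times> 'a \<Rightarrow> bool. u p}" for p
    using open_vimage[OF open_discrete[of "{True}"] continuous_on_product_coordinates[of p]]
    by (simp add: vimage_def)
  have closed_eval: "closed {u :: 'a \<times> 'a \<Rightarrow> bool. u p}" for p
    using closed_vimage[OF closed_singleton[of True] continuous_on_product_coordinates[of p]]
    by (simp add: vimage_def)
  have "closed ?K"
    unfolding left_order_iff mem_Collect_eq
    by (intro closed_Collect_conj closed_Collect_all closed_Collect_imp closed_Collect_disj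
        closed_Collect_neg closed_Collect_const open_Collect_const open_eval closed_eval)
  moreover have "compact_space (euclidean :: bool topology)"
    by (simp add: compact_space_def finite_imp_compact)
  then have "compact_space (euclidean :: ('a \<times> 'a \<Rightarrow> bool) topology)"
    unfolding euclidean_product_topology[symmetric] by (simp add: compact_space_product_topology)
  ultimately have K: "compactin euclidean ?K"
    using closedin_compact_space by fastforce
  have "continuous_map (top_of_set ?K) left_order_topology (\<lambda>u. {p. u p})"
    unfolding left_order_topology_def
  proof (rule continuous_on_generated_topo)
    fix U :: "'a rel set"
    assume "U \<in> insert left_orders {left_orders_less a b |a b. True}"
    then consider "U = left_orders" | a b where "U = left_orders_less a b"
      by blast
    then show "openin (top_of_set ?K) ((\<lambda>u. {p. u p}) -` U \<inter> topspace (top_of_set ?K))"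
    proof cases
      case 1
      then have "(\<lambda>u. {p. u p}) -` U \<inter> topspace (top_of_set ?K) = ?K"
        by (auto simp: left_orders_def)
      then show ?thesis
        by simp
    next
      case (2 a b)
      then have "(\<lambda>u. {p. u p}) -` U \<inter> topspace (top_of_set ?K) = ?K \<inter> {u. u (a, b)}"
        by (auto simp: left_orders_less_def left_orders_def)
      then show ?thesis
        using open_eval openin_open_Int by metis
    qed
  qed (auto simp: left_orders_def)
  then have "compactin left_order_topology ((\<lambda>u. {p. u p}) ` ?K)"
    using image_compactin[of "top_of_set ?K" ?K] K by (simp add: compactin_subtopology)
  moreover have "(\<lambda>u. {p. u p}) ` ?K = (left_orders :: 'a rel set)"
  proof
    show "(\<lambda>u. {p. u p}) ` ?K \<subseteq> left_orders"
      by (auto simp: left_orders_def)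
    show "left_orders \<subseteq> (\<lambda>u. {p. u p}) ` ?K"
    proof
      fix r :: "'a rel"
      assume "r \<in> left_orders"
      then show "r \<in> (\<lambda>u. {p. u p}) ` ?K"
        by (intro image_eqI[of _ _ "\<lambda>p. p \<in> r"]) (simp_all add: left_orders_def)
    qed
  qed
  ultimately show ?thesis
    by (simp add: compact_space_def topspace_left_order_topology)
qed

text \<open>
The sets of all left orders that extend a given finite relation form a base of the topology.
\<close>

lemma openin_left_order_topology_imp:
  assumes "openin left_order_topology U" "r \<in> U"
  shows "\<exists>E. finite E \<and> E \<subseteq> r \<and> {q \<in> left_orders. E \<subseteq> q} \<subseteq> U"
proof -
  have "generate_topology_on (insert left_orders {left_orders_less a b |a b. True}) U"
    using assms(1) unfolding left_order_topology_def by (simp add: openin_topology_generated_by)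
  then show ?thesis
    using assms(2)
  proof (induction U arbitrary: r)
    case Empty
    then show ?case by simp
  next
    case (Int U V)
    then obtain E D where "finite E" "E \<subseteq> r" "{q \<in> left_orders. E \<subseteq> q} \<subseteq> U"
      "finite D" "D \<subseteq> r" "{q \<in> left_orders. D \<subseteq> q} \<subseteq> V"
      by (meson IntD1 IntD2)
    then show ?case
      by (intro exI[of _ "E \<union> D"]) auto
  next
    case (UN K)
    then show ?case
      by (meson Union_iff Union_upper subset_trans)
  next
    case (Basis S)
    then consider "S = left_orders" | a b where "S = left_orders_less a b"
      by blast
    then show ?case
    proof cases
      case 1
      then show ?thesis by (intro exI[of _ "{}"]) auto
    next
      case (2 a b)
      then show ?thesis
        using Basis.prems by (intro exI[of _ "{(a, b)}"]) (auto simp: left_orders_less_def)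
    qed
  qed
qed

text \<open>
By totality, the complement is \<open>left_orders_less b a\<close> when \<open>a \<noteq> b\<close>.
\<close>

lemma closedin_left_orders_less:
  "closedin left_order_topology (left_orders_less a b)"
proof (cases "a = b")
  case True
  then have "left_orders_less a b = {}"
    unfolding left_orders_less_def left_orders_def using left_orderD(1) by auto
  then show ?thesis
    by simp
next
  case False
  have "topspace left_order_topology - left_orders_less a b = left_orders_less b a"
  proof -
    have "(a, b) \<notin> r \<longleftrightarrow> (b, a) \<in> r" if "left_order r" for r
      using left_orderD(1,2,3)[OF that] False by metis
    then show ?thesis
      unfolding topspace_left_order_topology left_orders_less_def left_orders_def by auto
  qed
  then show ?thesis
    unfolding closedin_def
    by (simp add: openin_left_orders_less topspace_left_order_topology)
      (simp add: left_orders_less_def)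
qed

text \<open>
A basic neighbourhood of \<open>r\<close> consists of the orders that extend a finite set of pairs, which by
translation amounts to finitely many differences being positive; these do not isolate the cone of \<open>r\<close>.
\<close>

lemma left_order_not_isolated:
  fixes x y :: "'a::torsion_free_ab_group"
  assumes xy: "x \<noteq> 0" "y \<noteq> 0"
    and independent: "\<And>j k. \<lbrakk>j > 0; k > 0\<rbrakk> \<Longrightarrow> nmul j x \<noteq> nmul k y \<and> nmul j x \<noteq> - nmul k y"
  shows "\<not> openin left_order_topology {r :: 'a rel}"
proof
  assume isolated: "openin left_order_topology {r}"
  then have "{r} \<subseteq> left_orders"
    using openin_subset topspace_left_order_topology by metis
  then have r: "left_order r"
    by (simp add: left_orders_def)
  have "\<exists>E. finite E \<and> E \<subseteq> r \<and> {q \<in> left_orders. E \<subseteq> q} \<subseteq> {r}"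
    by (rule openin_left_order_topology_imp[OF isolated]) simp
  then obtain E where E: "finite E" "E \<subseteq> r" "{q \<in> left_orders. E \<subseteq> q} \<subseteq> {r}"
    by iprover
  let ?F = "(\<lambda>(a, b). b - a) ` E"
  have "?F \<subseteq> cone_of r"
  proof
    fix g
    assume "g \<in> ?F"
    then obtain a b where "(a, b) \<in> r" "g = b - a"
      using E(2) by auto
    then show "g \<in> cone_of r"
      using left_order_less_iff[OF r, of a b] by (simp add: cone_of_def)
  qed
  then have "\<not> isolates (cone_of r) ?F"
    using not_isolates_finite[OF xy independent positive_cone_cone_of[OF r], of ?F] E(1) by simp
  then obtain Q where Q: "positive_cone Q" "?F \<subseteq> Q" "Q \<noteq> cone_of r"
    unfolding isolates_def by blast
  have "E \<subseteq> order_of Q"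
    using Q(2) unfolding order_of_def by auto
  moreover have "order_of Q \<in> left_orders"
    using left_order_order_of[OF Q(1)] by (simp add: left_orders_def)
  ultimately have "order_of Q = r"
    using E(3) by auto
  then show False
    using Q(3) cone_of_order_of[of Q] by simp
qed

lemma left_orders_nonempty:
  "left_orders \<noteq> ({} :: 'a::torsion_free_ab_group rel set)"
proof -
  have "zero_free_subsemigroup ({} :: 'a set)"
    by (simp add: zero_free_subsemigroup_def)
  then obtain P :: "'a set" where "positive_cone P"
    using positive_cone_extension by blast
  then show ?thesis
    using left_order_order_of[of P] unfolding left_orders_def by auto
qed

theorem left_order_topology_homeomorphic_cantor_set:
  fixes x y :: "'a::{torsion_free_ab_group, countable}"
  assumes xy: "x \<noteq> 0" "y \<noteq> 0"
    and independent: "\<And>j k. \<lbrakk>j > 0; k > 0\<rbrakk> \<Longrightarrow> nmul j x \<noteq> nmul k y \<and> nmul j x \<noteq> - nmul k y"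
  shows "(left_order_topology :: 'a rel topology) homeomorphic_space top_of_set cantor_set"
proof -
  interpret perfect_clopen_separated "left_order_topology :: 'a rel topology"
    "\<lambda>k. left_orders_less 0 (from_nat k)"
  proof
    show "compact_space (left_order_topology :: 'a rel topology)"
      by (rule compact_space_left_order_topology)
    show "topspace (left_order_topology :: 'a rel topology) \<noteq> {}"
      unfolding topspace_left_order_topology by (rule left_orders_nonempty)
    show "\<not> openin left_order_topology {r :: 'a rel}" for r
      by (rule left_order_not_isolated[OF xy independent])
    fix r q :: "'a rel"
    assume "r \<in> topspace left_order_topology" "q \<in> topspace left_order_topology" "r \<noteq> q"
    then have rq: "left_order r" "left_order q" "r \<noteq> q"
      by (simp_all add: topspace_left_order_topology left_orders_def)
    then have "cone_of r \<noteq> cone_of q"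
      using order_of_cone_of by metis
    then obtain g where "g \<in> cone_of r \<longleftrightarrow> g \<notin> cone_of q"
      by blast
    then show "\<exists>k. r \<in> left_orders_less 0 (from_nat k) \<longleftrightarrow> q \<notin> left_orders_less 0 (from_nat k)"
      using rq(1,2) by (intro exI[of _ "to_nat g"])
        (auto simp: left_orders_less_def left_orders_def cone_of_def)
  qed (rule openin_left_orders_less closedin_left_orders_less)+
  show ?thesis
    by (rule homeomorphic_cantor_set)
qed

section \<open>Free abelian groups of finite rank\<close>

lemma nmul_int: "nmul k g = int k * g"
  by (induction k) (simp_all add: algebra_simps)

lemma nmul_vec_nth: "nmul k v $ i = nmul k (v $ i)"
  by (induction k) simp_all

instance int :: torsion_free_ab_group
  by standard (simp add: nmul_int)

instance vec :: (torsion_free_ab_group, finite) torsion_free_ab_group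
proof
  fix k :: nat and v :: "'a ^ 'b"
  assume "k > 0" "nmul k v = 0"
  then have "v $ i = 0" for i
    using torsion_free[of k "v $ i"] nmul_vec_nth[of k v i] by simp
  then show "v = 0"
    by (simp add: vec_eq_iff)
qed

theorem proposition1p7:
  assumes "CARD('n::finite) > 1"
  shows "(left_order_topology :: (int ^ 'n) rel topology) homeomorphic_space top_of_set cantor_set"
proof -
  obtain i j :: 'n where "i \<noteq> j"
    using assms card_le_Suc0_iff_eq[of "UNIV :: 'n set"] by auto
  show ?thesis
  proof (rule left_order_topology_homeomorphic_cantor_set)
    show "axis i (1::int) \<noteq> 0" "axis j (1::int) \<noteq> 0"
      by simp_all
    fix m k :: nat
    assume "m > 0" "k > 0"
    have "nmul m (axis i 1) $ i = int m" "nmul k (axis j 1) $ i = (0::int)"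
      using \<open>i \<noteq> j\<close> by (simp_all add: nmul_vec_nth nmul_int axis_def)
    with \<open>m > 0\<close> show "nmul m (axis i (1::int)) \<noteq> nmul k (axis j 1)
        \<and> nmul m (axis i (1::int)) \<noteq> - nmul k (axis j 1)"
      by (metis minus_zero of_nat_eq_0_iff not_gr_zero vector_uminus_component)
  qed
qed

end
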